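(* Let $X$ be a nonempty set and $Y$ a nonempty subset of $X$. The semigroup $\overline{S}(X,Y)$ is unit-regular if and only if $X\setminus Y$ is finite.
   Context: $T(X)$ is the semigroup of all maps $X\to X$ under composition; maps are written on the right and composed from left to right, so $x(fg)=(xf)g$, and $Yf=\{yf\colon y\in Y\}$. If $Yf\subseteq Y$, then $f_{\upharpoonright Y}\colon Y\to Y$ denotes the map that agrees with $f$ on $Y$. Let $S(Y)$ be the symmetric group on $Y$ (all bijections $Y\to Y$), and let $\overline{S}(X,Y)=\{f\in T(X)\colon Yf\subseteq Y \text{ and } f_{\upharpoonright Y}\in S(Y)\}$, a subsemigroup of $T(X)$ containing the identity map. A semigroup $S$ with identity is unit-regular if for every $a\in S$ there exists a unit $b$ of $S$ with $aba=a$. *)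

theory Defs
  imports "HOL-Algebra.Bij"
begin

text \<open>
  Maps \<open>X \<rightarrow> X\<close> on a carrier set are represented by the extensional functions
  \<^term>\<open>X \<rightarrow>\<^sub>E X\<close>, so that equality is equality of maps on \<open>X\<close>. Maps act on the right and
  are composed from left to right: \<open>f \<otimes> g\<close> is first \<open>f\<close>, then \<open>g\<close>.
\<close>

definition full_trans :: "'a set \<Rightarrow> ('a \<Rightarrow> 'a) monoid"
  where "full_trans X =
    \<lparr>carrier = X \<rightarrow>\<^sub>E X, mult = (\<lambda>f g. compose X g f), one = (\<lambda>x\<in>X. x)\<rparr>"

text \<open>\<^term>\<open>Bij Y\<close> is the carrier of the symmetric group on \<open>Y\<close>.\<close>

definition Sbar :: "'a set \<Rightarrow> 'a set \<Rightarrow> ('a \<Rightarrow> 'a) monoid"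
  where "Sbar X Y = (full_trans X)
    \<lparr>carrier := {f \<in> carrier (full_trans X). f ` Y \<subseteq> Y \<and> restrict f Y \<in> Bij Y}\<rparr>"

definition unit_regular :: "('a, 'b) monoid_scheme \<Rightarrow> bool"
  where "unit_regular S \<longleftrightarrow>
    monoid S \<and> (\<forall>a\<in>carrier S. \<exists>b\<in>Units S. a \<otimes>\<^bsub>S\<^esub> b \<otimes>\<^bsub>S\<^esub> a = a)"

lemma monoid_full_trans: "monoid (full_trans X)"
proof (rule monoidI)
  fix f g h assume "f \<in> carrier (full_trans X)" "g \<in> carrier (full_trans X)"
    "h \<in> carrier (full_trans X)"
  then show "f \<otimes>\<^bsub>full_trans X\<^esub> g \<otimes>\<^bsub>full_trans X\<^esub> h =
      f \<otimes>\<^bsub>full_trans X\<^esub> (g \<otimes>\<^bsub>full_trans X\<^esub> h)"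
    by (auto simp: full_trans_def compose_def fun_eq_iff)
qed (auto simp: full_trans_def compose_def fun_eq_iff PiE_iff extensional_def)

lemma submonoid_Sbar:
  assumes "Y \<subseteq> X"
  shows "submonoid (carrier (Sbar X Y)) (full_trans X)"
proof
  show "carrier (Sbar X Y) \<subseteq> carrier (full_trans X)"
    by (auto simp: Sbar_def)
  have "restrict (\<lambda>x\<in>X. x) Y = (\<lambda>x\<in>Y. x)"
    using assms by (auto simp: fun_eq_iff)
  then show "\<one>\<^bsub>full_trans X\<^esub> \<in> carrier (Sbar X Y)"
    using assms id_Bij[of Y] by (auto simp: Sbar_def full_trans_def)
next
  fix f g assume "f \<in> carrier (Sbar X Y)" "g \<in> carrier (Sbar X Y)"
  then have f: "f \<in> X \<rightarrow>\<^sub>E X" "f ` Y \<subseteq> Y" "restrict f Y \<in> Bij Y"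
    and g: "g \<in> X \<rightarrow>\<^sub>E X" "g ` Y \<subseteq> Y" "restrict g Y \<in> Bij Y"
    by (simp_all add: Sbar_def full_trans_def)
  have "restrict (compose X g f) Y = compose Y (restrict g Y) (restrict f Y)"
  proof
    fix x show "restrict (compose X g f) Y x = compose Y (restrict g Y) (restrict f Y) x"
      using f(2) assms by (cases "x \<in> Y") (auto simp: compose_def)
  qed
  moreover have "compose X g f \<in> X \<rightarrow>\<^sub>E X"
    using f(1) g(1) by (auto simp: compose_def)
  moreover have "compose X g f ` Y \<subseteq> Y"
    using f(2) g(2) assms by (auto simp: compose_def)
  ultimately show "f \<otimes>\<^bsub>full_trans X\<^esub> g \<in> carrier (Sbar X Y)"
    using compose_Bij[OF g(3) f(3)] by (simp add: Sbar_def full_trans_def)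
qed

lemma monoid_Sbar:
  assumes "Y \<subseteq> X"
  shows "monoid (Sbar X Y)"
  using submonoid.submonoid_is_monoid[OF submonoid_Sbar[OF assms] monoid_full_trans]
  by (simp add: Sbar_def)

end

theory Submission
  imports Defs
begin

text \<open>
  An equation \<open>a b a = a\<close> with a unit \<open>b\<close> asks for a permutation \<open>b\<close> of \<open>X\<close> that preserves \<open>Y\<close>
  and sends every point of the image of \<open>a\<close> to one of its preimages under \<open>a\<close>
  (lemmas \<open>mult_mult_eq_iff\<close> and \<open>Units_Sbar_iff\<close>). Since \<open>a\<close> permutes \<open>Y\<close>, on \<open>Y\<close> the only
  candidate is the inverse of \<open>a\<close> restricted to \<open>Y\<close>, and a point of the image outside \<open>Y\<close> has
  all its preimages in \<open>X - Y\<close>. Thus the whole question is whether a choice of preimages, which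
  is an injective map from part of \<open>X - Y\<close> into \<open>X - Y\<close>, extends to a permutation of \<open>X - Y\<close>.

  If \<open>X - Y\<close> is finite, every partial injection extends, by counting
  (lemma \<open>extend_inj_on_to_permutation\<close>). If \<open>X - Y\<close> is infinite, take for \<open>a\<close> the identity on
  \<open>Y\<close> together with an injective map of \<open>X - Y\<close> onto a proper subset: preimages are then unique,
  they already exhaust \<open>X\<close>, and a permutation has no room for the points that \<open>a\<close> misses
  (lemma \<open>surj_if_inj_and_regular\<close>).
\<close>

lemma carrier_Sbar_iff:
  "f \<in> carrier (Sbar X Y) \<longleftrightarrow> f \<in> X \<rightarrow>\<^sub>E X \<and> bij_betw f Y Y"
proof -
  have "restrict f Y \<in> Bij Y \<longleftrightarrow> bij_betw f Y Y"
    by (simp add: Bij_def)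
  then show ?thesis
    by (auto simp: Sbar_def full_trans_def bij_betw_def)
qed

lemma mult_Sbar: "f \<otimes>\<^bsub>Sbar X Y\<^esub> g = compose X g f"
  and one_Sbar: "\<one>\<^bsub>Sbar X Y\<^esub> = (\<lambda>x\<in>X. x)"
  by (simp_all add: Sbar_def full_trans_def)

lemma mult_mult_eq_iff:
  assumes "a \<in> carrier (Sbar X Y)" "b \<in> carrier (Sbar X Y)"
  shows "a \<otimes>\<^bsub>Sbar X Y\<^esub> b \<otimes>\<^bsub>Sbar X Y\<^esub> a = a \<longleftrightarrow> (\<forall>x\<in>X. a (b (a x)) = a x)"
proof -
  have "a \<in> extensional X"
    using assms by (simp add: carrier_Sbar_iff PiE_iff)
  then show ?thesis
    by (auto simp: mult_Sbar fun_eq_iff compose_def extensional_def)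
qed

lemma Units_Sbar_iff:
  assumes "Y \<subseteq> X"
  shows "f \<in> Units (Sbar X Y) \<longleftrightarrow> f \<in> carrier (Sbar X Y) \<and> bij_betw f X X"
proof
  assume "f \<in> Units (Sbar X Y)"
  then obtain g where f: "f \<in> carrier (Sbar X Y)" and g: "g \<in> carrier (Sbar X Y)"
    and gf: "compose X f g = (\<lambda>x\<in>X. x)" and fg: "compose X g f = (\<lambda>x\<in>X. x)"
    by (auto simp: Units_def mult_Sbar one_Sbar)
  have "f (g x) = x" "g (f x) = x" if "x \<in> X" for x
    using that fun_cong[OF gf, of x] fun_cong[OF fg, of x] by (simp_all add: compose_def)
  then have "bij_betw f X X"
    using f g by (intro bij_betwI[where g = g]) (auto simp: carrier_Sbar_iff)
  with f show "f \<in> carrier (Sbar X Y) \<and> bij_betw f X X" ..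
next
  assume "f \<in> carrier (Sbar X Y) \<and> bij_betw f X X"
  then have f: "f \<in> carrier (Sbar X Y)" and bij: "bij_betw f X X"
    by auto
  let ?g = "restrict (inv_into X f) X"
  have gX: "inv_into X f \<in> X \<rightarrow> X"
    using bij_betw_inv_into[OF bij] by (auto simp: bij_betw_def)
  \<comment> \<open>The inverse preserves \<open>Y\<close> because \<open>f\<close> maps \<open>Y\<close> onto \<open>Y\<close>, not merely into it.\<close>
  have "bij_betw (inv_into X f) Y Y"
    using f assms bij by (intro bij_betw_inv_into_subset[OF bij]) (auto simp: carrier_Sbar_iff bij_betw_def)
  then have "bij_betw ?g Y Y"
    using assms by (subst bij_betw_cong[of Y ?g "inv_into X f"]) auto
  with gX have g: "?g \<in> carrier (Sbar X Y)"
    by (auto simp: carrier_Sbar_iff)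
  have fX: "f \<in> X \<rightarrow> X"
    using f by (auto simp: carrier_Sbar_iff)
  have "compose X f ?g = (\<lambda>x\<in>X. x)" "compose X ?g f = (\<lambda>x\<in>X. x)"
    using bij fX gX
    by (auto simp: fun_eq_iff compose_def bij_betw_inv_into_left bij_betw_inv_into_right)
  with f g show "f \<in> Units (Sbar X Y)"
    by (auto simp: Units_def mult_Sbar one_Sbar)
qed

text \<open>
  In a finite set the complements of the domain and of the range of a partial injection have
  equally many elements, so they can be matched.
\<close>

lemma extend_inj_on_to_permutation:
  assumes "finite Z" "W \<subseteq> Z" "inj_on s W" "s ` W \<subseteq> Z"
  obtains t where "bij_betw t Z Z" "\<And>w. w \<in> W \<Longrightarrow> t w = s w"
proof -
  have "card (Z - W) = card (Z - s ` W)"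
    using assms by (simp add: card_Diff_subset finite_subset card_image)
  then obtain r where r: "bij_betw r (Z - W) (Z - s ` W)"
    using assms(1) finite_same_card_bij by blast
  let ?t = "\<lambda>z. if z \<in> W then s z else r z"
  have "bij_betw ?t W (s ` W)"
    using assms(3) by (subst bij_betw_cong[of W ?t s]) (auto simp: bij_betw_def)
  moreover have "bij_betw ?t (Z - W) (Z - s ` W)"
    using r by (subst bij_betw_cong[of "Z - W" ?t r]) auto
  ultimately have "bij_betw ?t (W \<union> (Z - W)) (s ` W \<union> (Z - s ` W))"
    by (rule bij_betw_combine) auto
  then have "bij_betw ?t Z Z"
    using assms(2,4) by (simp add: Un_absorb1)
  then show thesis
    by (rule that) simp
qed

lemma unit_inner_inverse_if_finite_complement:
  assumes "Y \<subseteq> X" "finite (X - Y)" "a \<in> carrier (Sbar X Y)"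
  obtains b where "b \<in> Units (Sbar X Y)" "a \<otimes>\<^bsub>Sbar X Y\<^esub> b \<otimes>\<^bsub>Sbar X Y\<^esub> a = a"
proof -
  have aX: "a x \<in> X" if "x \<in> X" for x
    using assms(3) that by (auto simp: carrier_Sbar_iff)
  have aY: "bij_betw a Y Y"
    using assms(3) by (simp add: carrier_Sbar_iff)
  define W where "W = a ` X - Y"
  have W: "W \<subseteq> a ` X" "W \<subseteq> X - Y"
    using aX by (auto simp: W_def)
  have a_s: "a (inv_into X a w) = w" "inv_into X a w \<in> X" if "w \<in> W" for w
    using that W by (auto simp: f_inv_into_f inv_into_into)
  have "inj_on (inv_into X a) W"
    using W(1) by (rule inj_on_inv_into)
  moreover have "inv_into X a ` W \<subseteq> X - Y"
  proof clarify
    fix w assume w: "w \<in> W"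
    \<comment> \<open>A preimage in \<open>Y\<close> would force the point itself into \<open>Y\<close>.\<close>
    have "inv_into X a w \<notin> Y"
    proof
      assume "inv_into X a w \<in> Y"
      then have "a (inv_into X a w) \<in> Y"
        using aY by (auto simp: bij_betw_def)
      with w a_s(1) W(2) show False by auto
    qed
    with a_s(2)[OF w] show "inv_into X a w \<in> X - Y" by simp
  qed
  ultimately obtain t where t: "bij_betw t (X - Y) (X - Y)"
    and ts: "\<And>w. w \<in> W \<Longrightarrow> t w = inv_into X a w"
    using extend_inj_on_to_permutation[OF assms(2) W(2)] by metis
  let ?b = "\<lambda>x\<in>X. if x \<in> Y then inv_into Y a x else t x"
  have bY: "bij_betw ?b Y Y"
    using bij_betw_inv_into[OF aY] assms(1)
    by (subst bij_betw_cong[of Y ?b "inv_into Y a"]) auto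
  have "bij_betw ?b (X - Y) (X - Y)"
    using t by (subst bij_betw_cong[of "X - Y" ?b t]) auto
  with bY have "bij_betw ?b (Y \<union> (X - Y)) (Y \<union> (X - Y))"
    by (rule bij_betw_combine) auto
  then have bX: "bij_betw ?b X X"
    using assms(1) by (simp add: Un_absorb1)
  then have "?b \<in> X \<rightarrow>\<^sub>E X"
    unfolding PiE_iff by (blast intro: bij_betwE[THEN bspec] restrict_extensional)
  with bY have bS: "?b \<in> carrier (Sbar X Y)"
    unfolding carrier_Sbar_iff by blast
  have "a (?b (a x)) = a x" if "x \<in> X" for x
  proof (cases "a x \<in> Y")
    case True
    with aY aX[OF that] show ?thesis by (simp add: bij_betw_inv_into_right)
  next
    case False
    with that have "a x \<in> W" by (simp add: W_def)
    with False aX[OF that] ts a_s show ?thesis by simp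
  qed
  then show thesis
    using that[of ?b] bS bX assms by (simp add: Units_Sbar_iff mult_mult_eq_iff)
qed

text \<open>
  Cancelling the injective map \<open>a\<close> in \<open>a b a = a\<close> shows that \<open>b\<close> is inverse to \<open>a\<close> on the image
  of \<open>a\<close>; as a permutation, \<open>b\<close> then admits no point outside that image.
\<close>

lemma surj_if_inj_and_regular:
  assumes "Y \<subseteq> X" "a \<in> carrier (Sbar X Y)" "inj_on a X"
    and "b \<in> Units (Sbar X Y)" "a \<otimes>\<^bsub>Sbar X Y\<^esub> b \<otimes>\<^bsub>Sbar X Y\<^esub> a = a"
  shows "a ` X = X"
proof
  have aX: "a x \<in> X" if "x \<in> X" for x
    using assms(2) that by (auto simp: carrier_Sbar_iff)
  then show "a ` X \<subseteq> X" by auto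
  have b: "b \<in> carrier (Sbar X Y)" "bij_betw b X X"
    using assms(1,4) by (auto simp: Units_Sbar_iff)
  then have bX: "b x \<in> X" if "x \<in> X" for x
    using that by (auto simp: bij_betw_def)
  have aba: "a (b (a x)) = a x" if "x \<in> X" for x
    using assms(2,5) b(1) that by (simp add: mult_mult_eq_iff)
  have ba: "b (a x) = x" if "x \<in> X" for x
    using inj_onD[OF assms(3) aba] aX bX that by simp
  show "X \<subseteq> a ` X"
  proof
    fix z assume z: "z \<in> X"
    have "a (b z) = z"
      using b(2) ba[OF bX[OF z]] aX[OF bX[OF z]] z by (auto simp: bij_betw_def dest: inj_onD)
    with bX[OF z] show "z \<in> a ` X" by force
  qed
qed

lemma inj_not_surj_in_Sbar_if_infinite_complement:
  assumes "Y \<subseteq> X" "infinite (X - Y)"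
  obtains a where "a \<in> carrier (Sbar X Y)" "inj_on a X" "a ` X \<noteq> X"
proof -
  obtain z where z: "z \<in> X - Y"
    using assms(2) infinite_imp_nonempty by blast
  obtain h where h: "bij_betw h (X - Y) (X - Y - {z})"
    using infinite_imp_bij_betw[OF assms(2)] by blast
  let ?a = "\<lambda>x\<in>X. if x \<in> Y then x else h x"
  have aY: "bij_betw ?a Y Y"
    using assms(1) by (subst bij_betw_cong[of Y ?a id]) auto
  have "bij_betw ?a (X - Y) (X - Y - {z})"
    using h by (subst bij_betw_cong[of "X - Y" ?a h]) auto
  with aY have "bij_betw ?a (Y \<union> (X - Y)) (Y \<union> (X - Y - {z}))"
    by (rule bij_betw_combine) auto
  moreover have "Y \<union> (X - Y) = X" "Y \<union> (X - Y - {z}) = X - {z}"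
    using assms(1) z by auto
  ultimately have aX: "bij_betw ?a X (X - {z})"
    by simp
  then have "?a \<in> X \<rightarrow>\<^sub>E X"
    unfolding PiE_iff using bij_betwE[OF aX] by (blast intro: restrict_extensional)
  with aY have "?a \<in> carrier (Sbar X Y)"
    unfolding carrier_Sbar_iff by blast
  moreover have "inj_on ?a X" "?a ` X \<noteq> X"
    using aX z unfolding bij_betw_def by blast+
  ultimately show thesis
    by (rule that)
qed

theorem theorem3p8:
  fixes X Y :: "'a set"
  assumes "X \<noteq> {}" and "Y \<noteq> {}" and "Y \<subseteq> X"
  shows "unit_regular (Sbar X Y) \<longleftrightarrow> finite (X - Y)"
proof
  assume reg: "unit_regular (Sbar X Y)"
  show "finite (X - Y)"
  proof (rule ccontr)
    assume "infinite (X - Y)"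
    then obtain a where a: "a \<in> carrier (Sbar X Y)" "inj_on a X" "a ` X \<noteq> X"
      using inj_not_surj_in_Sbar_if_infinite_complement[OF assms(3)] by blast
    obtain b where "b \<in> Units (Sbar X Y)" "a \<otimes>\<^bsub>Sbar X Y\<^esub> b \<otimes>\<^bsub>Sbar X Y\<^esub> a = a"
      using reg a(1) unfolding unit_regular_def by blast
    with surj_if_inj_and_regular[OF assms(3) a(1,2)] a(3) show False
      by blast
  qed
next
  assume "finite (X - Y)"
  then show "unit_regular (Sbar X Y)"
    unfolding unit_regular_def
    using monoid_Sbar[OF assms(3)] unit_inner_inverse_if_finite_complement[OF assms(3)] by metis
qed

end
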